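(* Let $\mathscr{F}\subseteq\mathscr{P}(\omega)$ be an $\omega$-closed family with $\varnothing\in\mathscr{F}$. Then the semigroup $\boldsymbol{B}_{\omega}^{\mathscr{F}}$ is $0$-simple if and only if for all nonempty sets $F_1,F_2\in\mathscr{F}$ there exist $k_1,k_2\in\omega$ such that $F_1\subseteq -k_1+F_2$ and $F_2\subseteq -k_2+F_1$.
   Context: $\omega$ is the set of non-negative integers, $\mathscr{P}(\omega)$ its power set. For an integer $n$ and $F\subseteq\omega$ put $n+F=\{n+k\colon k\in F\}\subseteq\mathbb{Z}$ (empty if $F=\varnothing$). A family $\mathscr{F}\subseteq\mathscr{P}(\omega)$ is $\omega$-closed if $F_1\cap(-n+F_2)\in\mathscr{F}$ for all $n\in\omega$ and $F_1,F_2\in\mathscr{F}$. Let $\boldsymbol{B}_{\omega}=\omega\times\omega$ (the underlying set of the bicyclic monoid). For an $\omega$-closed family $\mathscr{F}$, the set $\boldsymbol{B}_{\omega}\times\mathscr{F}=\omega\times\omega\times\mathscr{F}$ carries the semigroup operation $$(i_1,j_1,F_1)\cdot(i_2,j_2,F_2)=\begin{cases}(i_1-j_1+i_2,\,j_2,\,(j_1-i_2+F_1)\cap F_2), & j_1\leqslant i_2;\\ (i_1,\,j_1-i_2+j_2,\,F_1\cap(i_2-j_1+F_2)), & j_1\geqslant i_2.\end{cases}$$ If $\varnothing\in\mathscr{F}$, then $\boldsymbol{I}=\{(i,j,\varnothing)\colon i,j\in\omega\}$ is an ideal and $\boldsymbol{B}_{\omega}^{\mathscr{F}}$ is the Rees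 quotient $(\boldsymbol{B}_{\omega}\times\mathscr{F},\cdot)/\boldsymbol{I}$, in which all $(i,j,\varnothing)$ are identified to a single zero element $\boldsymbol{0}$. A semigroup $S$ with zero $0$ is $0$-simple if $S\cdot S\neq\{0\}$ and $\{0\}$ is the only proper two-sided ideal of $S$.
   Formalization: The family is additionally assumed to contain a nonempty set (it is not {∅}); for the family {∅} the semigroup is {0}, which is not 0-simple, while the condition on nonempty sets holds vacuously, so the equivalence fails there. *)

theory Defs
  imports Main
begin

text \<open>
  Subsets of \<open>\<omega>\<close> are terms of type \<open>nat set\<close>; a shift \<open>n + F\<close> is a set of integers.
  An intersection of \<open>F \<subseteq> \<omega>\<close> with a set \<open>A\<close> of integers is again a subset of \<open>\<omega>\<close>,
  and it is written \<open>F \<inter> int -` A\<close>.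
\<close>

definition shift :: "int \<Rightarrow> nat set \<Rightarrow> int set" where
  "shift n F = {n + int k | k. k \<in> F}"

definition omega_closed :: "nat set set \<Rightarrow> bool" where
  "omega_closed \<F> \<longleftrightarrow>
     (\<forall>n::nat. \<forall>F1\<in>\<F>. \<forall>F2\<in>\<F>. F1 \<inter> int -` shift (- int n) F2 \<in> \<F>)"


definition semigroup_on :: "'a set \<Rightarrow> ('a \<Rightarrow> 'a \<Rightarrow> 'a) \<Rightarrow> bool" where
  "semigroup_on S f \<longleftrightarrow>
     (\<forall>x\<in>S. \<forall>y\<in>S. f x y \<in> S) \<and>
     (\<forall>x\<in>S. \<forall>y\<in>S. \<forall>z\<in>S. f (f x y) z = f x (f y z))"

definition ideal_on :: "'a set \<Rightarrow> ('a \<Rightarrow> 'a \<Rightarrow> 'a) \<Rightarrow> 'a set \<Rightarrow> bool" where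
  "ideal_on S f I \<longleftrightarrow>
     I \<noteq> {} \<and> I \<subseteq> S \<and> (\<forall>s\<in>S. \<forall>x\<in>I. f s x \<in> I \<and> f x s \<in> I)"

definition zero_simple :: "'a set \<Rightarrow> ('a \<Rightarrow> 'a \<Rightarrow> 'a) \<Rightarrow> 'a \<Rightarrow> bool" where
  "zero_simple S f z \<longleftrightarrow>
     semigroup_on S f \<and>
     z \<in> S \<and> (\<forall>x\<in>S. f z x = z \<and> f x z = z) \<and>
     {f x y | x y. x \<in> S \<and> y \<in> S} \<noteq> {z} \<and>
     {I. ideal_on S f I \<and> I \<noteq> S} = {{z}}"


definition rees_cong :: "'a set \<Rightarrow> 'a set \<Rightarrow> ('a \<times> 'a) set" where
  "rees_cong S I = {(x, y) \<in> S \<times> S. x = y \<or> (x \<in> I \<and> y \<in> I)}"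

definition rees_mult ::
    "'a set \<Rightarrow> ('a \<Rightarrow> 'a \<Rightarrow> 'a) \<Rightarrow> 'a set \<Rightarrow> 'a set \<Rightarrow> 'a set \<Rightarrow> 'a set" where
  "rees_mult S f I X Y = (\<Union>x\<in>X. \<Union>y\<in>Y. rees_cong S I `` {f x y})"


type_synonym bwf = "nat \<times> nat \<times> nat set"

definition bw_carrier :: "nat set set \<Rightarrow> bwf set" where
  "bw_carrier \<F> = UNIV \<times> UNIV \<times> \<F>"

text \<open>
  The two cases of the defining formula agree when \<open>j1 = i2\<close>.  The first coordinate
  \<open>i1 - j1 + i2\<close> is written \<open>i1 + (i2 - j1)\<close> to avoid truncated subtraction
  on \<open>nat\<close>, and likewise for the second coordinate.
\<close>

fun bw_mult :: "bwf \<Rightarrow> bwf \<Rightarrow> bwf" where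
  "bw_mult (i1, j1, F1) (i2, j2, F2) =
     (if j1 \<le> i2
      then (i1 + (i2 - j1), j2, int -` shift (int j1 - int i2) F1 \<inter> F2)
      else (i1, (j1 - i2) + j2, F1 \<inter> int -` shift (int i2 - int j1) F2))"

definition bw_null :: "bwf set" where
  "bw_null = {(i, j, {}) | i j. True}"

text \<open>
  For \<open>{} \<in> \<F>\<close>: the carrier, the operation and the zero element of the Rees quotient
  \<open>B\<^sub>\<omega>\<^sup>\<F>\<close>.  Its elements are congruence classes, and its zero is the class \<open>bw_null\<close>.
\<close>

definition BwF_carrier :: "nat set set \<Rightarrow> bwf set set" where
  "BwF_carrier \<F> = bw_carrier \<F> // rees_cong (bw_carrier \<F>) bw_null"

definition BwF_mult :: "nat set set \<Rightarrow> bwf set \<Rightarrow> bwf set \<Rightarrow> bwf set" where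
  "BwF_mult \<F> = rees_mult (bw_carrier \<F>) bw_mult bw_null"

definition BwF_zero :: "bwf set" where
  "BwF_zero = bw_null"


lemma equiv_rees_cong:
  "equiv S (rees_cong S I)"
  by (auto simp: rees_cong_def equiv_def refl_on_def sym_def trans_def)

lemma congruent2_rees_cong:
  assumes "semigroup_on S f" "ideal_on S f I"
  shows "congruent2 (rees_cong S I) (rees_cong S I) (\<lambda>x y. rees_cong S I `` {f x y})"
proof (rule congruent2I'[where ?r1.0 = "rees_cong S I" and ?r2.0 = "rees_cong S I"])
  fix x x' y y'
  assume h: "(x, x') \<in> rees_cong S I" "(y, y') \<in> rees_cong S I"
  have "(f x y, f x' y') \<in> rees_cong S I"
    using h assms unfolding rees_cong_def semigroup_on_def ideal_on_def by auto
  then show "rees_cong S I `` {f x y} = rees_cong S I `` {f x' y'}"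
    by (rule equiv_class_eq[OF equiv_rees_cong])
qed

lemma rees_mult_class:
  assumes "semigroup_on S f" "ideal_on S f I" "x \<in> S" "y \<in> S"
  shows "rees_mult S f I (rees_cong S I `` {x}) (rees_cong S I `` {y})
         = rees_cong S I `` {f x y}"
  unfolding rees_mult_def
  by (rule UN_equiv_class2[OF equiv_rees_cong equiv_rees_cong
        congruent2_rees_cong[OF assms(1,2)] assms(3,4)])

lemma int_mem_shift:
  "m \<le> n \<Longrightarrow> int k \<in> shift (int m - int n) F \<longleftrightarrow> k + (n - m) \<in> F"
proof -
  assume "m \<le> n"
  then have "int k = int m - int n + int l \<longleftrightarrow> l = k + (n - m)" for l
    by auto
  then show ?thesis by (auto simp: shift_def)
qed

lemma bw_mult_alt:
  "bw_mult (i1, j1, F1) (i2, j2, F2) =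
     (i1 + (i2 - j1), j2 + (j1 - i2), {k. k + (i2 - j1) \<in> F1 \<and> k + (j1 - i2) \<in> F2})"
  by (auto simp: int_mem_shift)

lemma semigroup_bw:
  assumes "omega_closed \<F>"
  shows "semigroup_on (bw_carrier \<F>) bw_mult"
proof -
  have cl: "F1 \<inter> int -` shift (int m - int n) F2 \<in> \<F>"
    if "m \<le> n" "F1 \<in> \<F>" "F2 \<in> \<F>" for m n F1 F2
  proof -
    have "int m - int n = - int (n - m)" using that by simp
    then show ?thesis using assms that unfolding omega_closed_def by metis
  qed
  have "bw_mult x y \<in> bw_carrier \<F>"
    if "x \<in> bw_carrier \<F>" "y \<in> bw_carrier \<F>" for x y
    using that cl by (cases x; cases y) (auto simp: bw_carrier_def Int_commute)
  moreover have "bw_mult (bw_mult x y) z = bw_mult x (bw_mult y z)" for x y z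
  proof -
    obtain i1 j1 F1 i2 j2 F2 i3 j3 F3
      where xyz: "x = (i1, j1, F1)" "y = (i2, j2, F2)" "z = (i3, j3, F3)"
      by (metis prod_cases3)
    have e: "k + (i3 - (j2 + (j1 - i2))) + (i2 - j1) = k + (i2 + (i3 - j2) - j1)"
      "k + (i3 - (j2 + (j1 - i2))) + (j1 - i2) = k + (j1 - (i2 + (i3 - j2))) + (i3 - j2)"
      "k + (j2 + (j1 - i2) - i3) = k + (j1 - (i2 + (i3 - j2))) + (j2 - i3)" for k
      by arith+
    then show ?thesis
      unfolding xyz bw_mult_alt mem_Collect_eq e prod.inject by (simp add: conj_assoc)
  qed
  ultimately show ?thesis by (simp add: semigroup_on_def)
qed

lemma ideal_bw_null:
  assumes "{} \<in> \<F>"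
  shows "ideal_on (bw_carrier \<F>) bw_mult bw_null"
  using assms by (auto simp: ideal_on_def bw_carrier_def bw_null_def shift_def)

lemma BwF_zero_class:
  assumes "{} \<in> \<F>"
  shows "BwF_zero = rees_cong (bw_carrier \<F>) bw_null `` {(i, j, {})}"
  using assms by (auto simp: BwF_zero_def rees_cong_def bw_carrier_def bw_null_def)

end

theory Submission
  imports Defs
begin

text \<open>
  Ideals of a Rees quotient \<open>S/I\<close> correspond to the ideals of \<open>S\<close> that contain \<open>I\<close>, so
  0-simplicity of the quotient is a property of \<open>S\<close> itself: some product lies outside \<open>I\<close>, and
  nothing lies strictly between \<open>I\<close> and \<open>S\<close> among the ideals (\<open>zero_simple_rees_iff\<close>).

  For the bicyclic extension, the set component of a product is contained in a backward shift of
  the set component of each factor.  Hence, for fixed \<open>F\<close>, the triples whose set component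
  embeds by a shift into \<open>F\<close> form an ideal containing the null triples (\<open>ideal_shift_below\<close>);
  if there are no intermediate ideals, this one is everything, which gives the shift condition for
  \<open>F\<close>.  Conversely, if \<open>G\<close> embeds into \<open>F\<close> by the shift \<open>k\<close>, then every triple with
  set component \<open>G\<close> is obtained from any triple with set component \<open>F\<close> by multiplying on the
  left and on the right with suitable triples over \<open>G\<close> (\<open>bw_sandwich\<close>), so an ideal that
  contains one non-null triple contains them all.
\<close>

section \<open>Zero-simplicity of Rees quotients\<close>

lemma rees_class_eq_iff:
  assumes "I \<subseteq> S" "x \<in> S" "y \<in> S"
  shows "rees_cong S I `` {x} = rees_cong S I `` {y} \<longleftrightarrow> x = y \<or> x \<in> I \<and> y \<in> I"
  using eq_equiv_class_iff[OF equiv_rees_cong assms(2,3)] assms by (auto simp: rees_cong_def)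

lemma rees_class_eq_zero_iff:
  assumes "I \<subseteq> S" "I \<noteq> {}" "x \<in> S"
  shows "rees_cong S I `` {x} = I \<longleftrightarrow> x \<in> I"
  using assms by (auto simp: rees_cong_def)

text \<open>
  The two ideal correspondences are the preimage and the image under the quotient map.  No clause
  \<open>I \<noteq> S\<close> occurs on the right, since a product outside \<open>I\<close> already makes \<open>I\<close> proper.
\<close>

lemma zero_simple_rees_iff:
  assumes S: "semigroup_on S f" and I: "ideal_on S f I"
  shows "zero_simple (S // rees_cong S I) (rees_mult S f I) I \<longleftrightarrow>
    (\<exists>x\<in>S. \<exists>y\<in>S. f x y \<notin> I) \<and>
    (\<forall>J. ideal_on S f J \<longrightarrow> I \<subseteq> J \<longrightarrow> J = I \<or> J = S)"
    (is "?L \<longleftrightarrow> ?P \<and> ?M")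
proof -
  define p where "p x = rees_cong S I `` {x}" for x
  define Q where "Q = S // rees_cong S I"
  define g where "g = rees_mult S f I"
  have Q: "Q = p ` S"
    by (auto simp: Q_def p_def quotient_def)
  have g: "g (p x) (p y) = p (f x y)" if "x \<in> S" "y \<in> S" for x y
    using rees_mult_class[OF S I that] by (simp add: g_def p_def)
  have cl: "f x y \<in> S" if "x \<in> S" "y \<in> S" for x y
    using S that by (auto simp: semigroup_on_def)
  have IS: "I \<subseteq> S" and Ine: "I \<noteq> {}"
    using I by (auto simp: ideal_on_def)
  have Iabs: "f x y \<in> I" "f y x \<in> I" if "x \<in> S" "y \<in> I" for x y
    using I that by (auto simp: ideal_on_def)
  have peq: "p x = p y \<longleftrightarrow> x = y \<or> x \<in> I \<and> y \<in> I" if "x \<in> S" "y \<in> S" for x y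
    using rees_class_eq_iff[OF IS that] by (simp add: p_def)
  have pI: "p x = I \<longleftrightarrow> x \<in> I" if "x \<in> S" for x
    using rees_class_eq_zero_iff[OF IS Ine that] by (simp add: p_def)
  obtain e where e: "e \<in> I" "e \<in> S" "p e = I"
    using Ine IS pI by blast
  have sg: "semigroup_on Q g"
    using S by (auto simp: semigroup_on_def Q g)
  have zero: "I \<in> Q" "\<forall>x\<in>Q. g I x = I \<and> g x I = I"
  proof -
    show "I \<in> Q" using e by (auto simp: Q)
    have "g (p e) (p x) = I \<and> g (p x) (p e) = I" if "x \<in> S" for x
      using that e by (simp add: g pI cl Iabs)
    then show "\<forall>x\<in>Q. g I x = I \<and> g x I = I"
      using e by (simp add: Q)
  qed
  have prods: "{g x y | x y. x \<in> Q \<and> y \<in> Q} \<noteq> {I} \<longleftrightarrow> ?P"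
  proof -
    have "g I I = I" using zero by simp
    then have "I \<in> {g x y | x y. x \<in> Q \<and> y \<in> Q}" using zero(1) by force
    then have "{g x y | x y. x \<in> Q \<and> y \<in> Q} = {I} \<longleftrightarrow>
        {g x y | x y. x \<in> Q \<and> y \<in> Q} \<subseteq> {I}"
      by (simp only: set_eq_subset empty_subsetI insert_subset simp_thms)
    also have "\<dots> \<longleftrightarrow> (\<forall>x\<in>Q. \<forall>y\<in>Q. g x y = I)"
      by auto
    also have "\<dots> \<longleftrightarrow> (\<forall>x\<in>S. \<forall>y\<in>S. f x y \<in> I)"
      by (simp add: Q g pI cl)
    finally show ?thesis by (simp only:) blast
  qed
  have zid: "ideal_on Q g {I}"
    using zero by (auto simp: ideal_on_def)
  have ideals: "{K. ideal_on Q g K \<and> K \<noteq> Q} = {{I}} \<longleftrightarrow> ?M" if ?P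
  proof
    assume *: "{K. ideal_on Q g K \<and> K \<noteq> Q} = {{I}}"
    have only: "K = {I}" if "ideal_on Q g K" "K \<noteq> Q" for K
    proof -
      have "K \<in> {K. ideal_on Q g K \<and> K \<noteq> Q}" using that by simp
      then show ?thesis unfolding * by simp
    qed
    show ?M
    proof (intro allI impI)
      fix J assume J: "ideal_on S f J" and IJ: "I \<subseteq> J"
      have JS: "J \<subseteq> S" using J by (auto simp: ideal_on_def)
      have "ideal_on Q g (p ` J)"
        unfolding ideal_on_def
      proof (intro conjI ballI)
        show "p ` J \<noteq> {}" using J by (auto simp: ideal_on_def)
        show "p ` J \<subseteq> Q" using JS by (auto simp: Q)
        fix s t assume "s \<in> Q" "t \<in> p ` J"
        then obtain x y where "x \<in> S" "y \<in> J" "s = p x" "t = p y"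
          by (auto simp: Q)
        moreover have "f x y \<in> J \<and> f y x \<in> J"
          using J calculation by (auto simp: ideal_on_def)
        ultimately show "g s t \<in> p ` J" "g t s \<in> p ` J"
          using JS by (auto simp: g subsetD)
      qed
      then consider "p ` J = Q" | "p ` J = {I}"
        using only by blast
      then show "J = I \<or> J = S"
      proof cases
        case 1
        have "x \<in> J" if x: "x \<in> S" for x
        proof -
          have "p x \<in> p ` J" unfolding 1 Q using x by simp
          then obtain y where "y \<in> J" "p x = p y" by blast
          then show ?thesis using peq[OF x, of y] JS IJ by auto
        qed
        then show ?thesis using JS by blast
      next
        case 2
        have "x \<in> I" if "x \<in> J" for x
        proof -
          have "p x \<in> p ` J" using that by simp
          then show ?thesis using that JS pI[of x] unfolding 2 by auto
        qed
        then show ?thesis using IJ by blast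
      qed
    qed
  next
    assume M: ?M
    have only: "K = {I}" if K: "ideal_on Q g K" and ne: "K \<noteq> Q" for K
    proof -
      define J where "J = {x \<in> S. p x \<in> K}"
      have KQ: "K \<subseteq> Q" using K by (auto simp: ideal_on_def)
      have "I \<in> K"
        using K zero KQ unfolding ideal_on_def by (metis all_not_in_conv subsetD)
      then have IJ: "I \<subseteq> J" using IS pI by (auto simp: J_def)
      have "f s x \<in> J \<and> f x s \<in> J" if "s \<in> S" "x \<in> J" for s x
      proof -
        have x: "x \<in> S" "p x \<in> K" using that by (auto simp: J_def)
        have "p s \<in> Q" using that by (auto simp: Q)
        then have "g (p s) (p x) \<in> K \<and> g (p x) (p s) \<in> K"
          using K x by (auto simp: ideal_on_def)
        then show ?thesis using that x by (simp add: g J_def cl)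
      qed
      then have "ideal_on S f J"
        using IJ Ine by (auto simp: ideal_on_def J_def)
      then have "J = I \<or> J = S" using M IJ by blast
      moreover have "K = p ` J" using KQ by (auto simp: J_def Q)
      ultimately have "K = p ` I" using ne Q by metis
      also have "\<dots> = {I}" using e pI IS by (auto simp: image_iff)
      finally show ?thesis .
    qed
    have proper: "{I} \<noteq> Q"
    proof -
      obtain x y where xy: "x \<in> S" "y \<in> S" "f x y \<notin> I" using \<open>?P\<close> by blast
      then have "p (f x y) \<in> Q" "p (f x y) \<noteq> I" by (simp_all add: Q cl pI)
      then show ?thesis by auto
    qed
    show "{K. ideal_on Q g K \<and> K \<noteq> Q} = {{I}}"
    proof (intro equalityI subsetI)
      fix K assume "K \<in> {K. ideal_on Q g K \<and> K \<noteq> Q}"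
      then have "K = {I}" by (intro only) simp_all
      then show "K \<in> {{I}}" by simp
    next
      fix K assume "K \<in> {{I}}"
      then show "K \<in> {K. ideal_on Q g K \<and> K \<noteq> Q}" using zid proper by simp
    qed
  qed
  have "zero_simple Q g I \<longleftrightarrow> ?P \<and> ?M"
  proof (cases ?P)
    case True
    show ?thesis
      unfolding zero_simple_def prods ideals[OF True] using sg zero True by simp
  next
    case False
    then show ?thesis unfolding zero_simple_def prods by simp
  qed
  then show ?thesis by (simp add: Q_def g_def)
qed

section \<open>Shifts and ideals of the bicyclic extension\<close>

lemma image_int_subset_shift_iff:
  "int ` F \<subseteq> shift (- int k) G \<longleftrightarrow> (\<forall>x\<in>F. x + k \<in> G)"
  using int_mem_shift[of 0 k _ G] by (auto simp: image_subset_iff)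

lemma ideal_shift_below:
  assumes cl: "omega_closed \<F>" and em: "{} \<in> \<F>"
  shows "ideal_on (bw_carrier \<F>) bw_mult
    {(i, j, G) | i j G. G \<in> \<F> \<and> (\<exists>k. \<forall>x\<in>G. x + k \<in> F)}" (is "ideal_on ?S _ ?J")
  unfolding ideal_on_def
proof (intro conjI ballI)
  show "?J \<noteq> {}" using em by blast
  show "?J \<subseteq> ?S" by (auto simp: bw_carrier_def)
  fix s t assume s: "s \<in> ?S" and t: "t \<in> ?J"
  obtain i1 j1 A where s': "s = (i1, j1, A)" by (cases s)
  obtain i2 j2 G k where t': "t = (i2, j2, G)" and k: "\<forall>x\<in>G. x + k \<in> F"
    using t by blast
  have "t \<in> ?S" using t by (auto simp: bw_carrier_def)
  then have "bw_mult s t \<in> ?S" "bw_mult t s \<in> ?S"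
    using semigroup_bw[OF cl] s by (auto simp: semigroup_on_def)
  \<comment> \<open>a product shifts the set of the factor over \<open>G\<close> by a constant, which is added to \<open>k\<close>\<close>
  moreover have "x + ((j1 - i2) + k) \<in> F" if "x + (j1 - i2) \<in> G" for x
    using k that by (metis add.assoc)
  moreover have "x + ((i1 - j2) + k) \<in> F" if "x + (i1 - j2) \<in> G" for x
    using k that by (metis add.assoc)
  ultimately show "bw_mult s t \<in> ?J" "bw_mult t s \<in> ?J"
    unfolding s' t' bw_mult_alt bw_carrier_def by blast+
qed

text \<open>
  The middle coordinate \<open>i + k\<close> of the left factor makes the product shift \<open>F\<close> by exactly \<open>k\<close>
  while leaving \<open>G\<close> in place; the right factor then only has to correct the second coordinate.
\<close>

lemma bw_sandwich:
  assumes "\<forall>x\<in>G. x + k \<in> F"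
  shows "bw_mult (bw_mult (a, i + k, G) (i, j, F)) (j + k, b, G) = (a, b, G)"
  using assms unfolding bw_mult_alt by auto

theorem mainTheorem7:
  fixes \<F> :: "nat set set"
  assumes "omega_closed \<F>"
    and "{} \<in> \<F>"
    and "\<F> \<noteq> {{}}"
  shows "zero_simple (BwF_carrier \<F>) (BwF_mult \<F>) BwF_zero \<longleftrightarrow>
    (\<forall>F1\<in>\<F>. \<forall>F2\<in>\<F>. F1 \<noteq> {} \<longrightarrow> F2 \<noteq> {} \<longrightarrow>
      (\<exists>k1 k2 :: nat. int ` F1 \<subseteq> shift (- int k1) F2 \<and> int ` F2 \<subseteq> shift (- int k2) F1))"
    (is "?L \<longleftrightarrow> ?R")
proof -
  let ?S = "bw_carrier \<F>"
  have nontriv: "\<exists>x\<in>?S. \<exists>y\<in>?S. bw_mult x y \<notin> bw_null"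
  proof -
    obtain F where F: "F \<in> \<F>" "F \<noteq> {}" using assms(2,3) by blast
    have "(0, 0, F) \<in> ?S" using F by (simp add: bw_carrier_def)
    moreover have "bw_mult (0, 0, F) (0, 0, F) \<notin> bw_null"
      using F by (simp add: bw_mult_alt bw_null_def del: bw_mult.simps)
    ultimately show ?thesis by blast
  qed
  have "?L \<longleftrightarrow> (\<forall>J. ideal_on ?S bw_mult J \<longrightarrow> bw_null \<subseteq> J \<longrightarrow> J = bw_null \<or> J = ?S)"
    unfolding BwF_carrier_def BwF_mult_def BwF_zero_def
    using zero_simple_rees_iff[OF semigroup_bw[OF assms(1)] ideal_bw_null[OF assms(2)]] nontriv
    by blast
  also have "\<dots> \<longleftrightarrow> (\<forall>G\<in>\<F>. \<forall>F\<in>\<F>. F \<noteq> {} \<longrightarrow> (\<exists>k. \<forall>x\<in>G. x + k \<in> F))"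
  proof (intro iffI ballI allI impI)
    fix G F assume M: "\<forall>J. ideal_on ?S bw_mult J \<longrightarrow> bw_null \<subseteq> J \<longrightarrow> J = bw_null \<or> J = ?S"
      and G: "G \<in> \<F>" and F: "F \<in> \<F>" "F \<noteq> {}"
    let ?J = "{(i, j, H) | i j H. H \<in> \<F> \<and> (\<exists>k. \<forall>x\<in>H. x + k \<in> F)} :: bwf set"
    have "bw_null \<subseteq> ?J" using assms(2) by (auto simp: bw_null_def)
    moreover have "(0, 0, F) \<in> ?J" using F by (auto intro: exI[of _ 0])
    moreover have "(0, 0, F) \<notin> bw_null" using F by (simp add: bw_null_def)
    ultimately have "?J = ?S"
      using M ideal_shift_below[OF assms(1,2)] by blast
    moreover have "(0, 0, G) \<in> ?S" using G by (simp add: bw_carrier_def)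
    ultimately have "(0, 0, G) \<in> ?J" by blast
    then show "\<exists>k. \<forall>x\<in>G. x + k \<in> F" by blast
  next
    fix J assume R: "\<forall>G\<in>\<F>. \<forall>F\<in>\<F>. F \<noteq> {} \<longrightarrow> (\<exists>k. \<forall>x\<in>G. x + k \<in> F)"
      and J: "ideal_on ?S bw_mult J" and nJ: "bw_null \<subseteq> J"
    have JS: "J \<subseteq> ?S" using J by (auto simp: ideal_on_def)
    have "J = ?S" if ne: "J \<noteq> bw_null"
    proof -
      obtain i j F where x: "(i, j, F) \<in> J" "(i, j, F) \<notin> bw_null"
        using ne nJ by (metis prod_cases3 subsetI subset_antisym)
      then have F: "F \<in> \<F>" "F \<noteq> {}"
        using JS by (auto simp: bw_carrier_def bw_null_def)
      have "(a, b, G) \<in> J" if G: "G \<in> \<F>" for a b G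
      proof -
        obtain k where k: "\<forall>x\<in>G. x + k \<in> F" using R G F by blast
        have "(a, i + k, G) \<in> ?S" "(j + k, b, G) \<in> ?S"
          using G by (auto simp: bw_carrier_def)
        then have "bw_mult (bw_mult (a, i + k, G) (i, j, F)) (j + k, b, G) \<in> J"
          using J x unfolding ideal_on_def by blast
        then show ?thesis unfolding bw_sandwich[OF k] .
      qed
      then show ?thesis using JS by (auto simp: bw_carrier_def)
    qed
    then show "J = bw_null \<or> J = ?S" by blast
  qed
  also have "\<dots> \<longleftrightarrow> ?R"
    unfolding image_int_subset_shift_iff by (metis empty_iff)
  finally show ?thesis .
qed

end
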